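(* For any integer $T\ge1$, let $\{(x^t,y^t)\}_{t=0}^T$ be generated by gradient descent ascent (GDA) with step size $\eta=\mathcal O(T^{-1/2})$. Then there exists a convex-concave smooth minimax problem instance $\min_{x\in\mathcal X}\max_{y\in\mathcal Y}f(x,y)$ such that, in order for some iterate $(x^t,y^t)$ with $t\le T$ to be an $\epsilon$-saddle point of this problem, it is necessary that $T=\Omega(\epsilon^{-2})$.
   Context: A convex-concave smooth minimax problem instance consists of nonempty convex sets $\mathcal X\subseteq\mathbb R^n$, $\mathcal Y\subseteq\mathbb R^d$ and a continuously differentiable $f:\mathbb R^n\times\mathbb R^d\to\mathbb R$ with Lipschitz continuous partial gradients on $\mathcal X\times\mathcal Y$, with $f(\cdot,y)$ convex for all $y\in\mathcal Y$ and $f(x,\cdot)$ concave for all $x\in\mathcal X$, together with an initial point $(x^0,y^0)\in\mathcal X\times\mathcal Y$. GDA with step size $\eta>0$: $x^{t+1}=\mathrm{proj}_{\mathcal X}(x^t-\eta\nabla_xf(x^t,y^t))$, $y^{t+1}=\mathrm{proj}_{\mathcal Y}(y^t+\eta\nabla_yf(x^t,y^t))$, $t=0,1,2,\dots$, where $\mathrm{proj}$ is Euclidean projection. $(x,y)\in\mathcal X\times\mathcal Y$ is an $\epsilon$-saddle point if $\max_{y'\in\mathcal Y}f(x,y')-\min_{x'\in\mathcal X}f(x',y)\le\epsilon$. The notations $\mathcal O,\Omega$ hide positive constants independent of $T$ and $\epsilon$. *)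

theory Defs
  imports "HOL-Analysis.Analysis"
begin

definition grad :: "('a::real_inner \<Rightarrow> real) \<Rightarrow> 'a \<Rightarrow> 'a"
  where "grad f x = (THE D. GDERIV f x :> D)"

definition grad_x :: "('a::real_inner \<times> 'b::real_inner \<Rightarrow> real) \<Rightarrow> 'a \<times> 'b \<Rightarrow> 'a"
  where "grad_x f z = grad (\<lambda>x. f (x, snd z)) (fst z)"

definition grad_y :: "('a::real_inner \<times> 'b::real_inner \<Rightarrow> real) \<Rightarrow> 'a \<times> 'b \<Rightarrow> 'b"
  where "grad_y f z = grad (\<lambda>y. f (fst z, y)) (snd z)"

definition continuously_differentiable :: "('a::real_inner \<Rightarrow> real) \<Rightarrow> bool"
  where "continuously_differentiable f \<longleftrightarrow>
    (\<exists>G. (\<forall>z. GDERIV f z :> G z) \<and> continuous_on UNIV G)"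

(* Closedness of X and Y is what makes the Euclidean projections well defined. *)
definition minimax_instance ::
    "'a::euclidean_space set \<Rightarrow> 'b::euclidean_space set \<Rightarrow> ('a \<times> 'b \<Rightarrow> real) \<Rightarrow> 'a \<times> 'b \<Rightarrow> bool"
  where "minimax_instance X Y f z0 \<longleftrightarrow>
    X \<noteq> {} \<and> convex X \<and> closed X \<and>
    Y \<noteq> {} \<and> convex Y \<and> closed Y \<and>
    continuously_differentiable f \<and>
    (\<exists>L. L-lipschitz_on (X \<times> Y) (grad_x f)) \<and>
    (\<exists>L. L-lipschitz_on (X \<times> Y) (grad_y f)) \<and>
    (\<forall>y\<in>Y. convex_on UNIV (\<lambda>x. f (x, y))) \<and>
    (\<forall>x\<in>X. concave_on UNIV (\<lambda>y. f (x, y))) \<and>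
    z0 \<in> X \<times> Y"

primrec gda ::
    "'a::euclidean_space set \<Rightarrow> 'b::euclidean_space set \<Rightarrow> ('a \<times> 'b \<Rightarrow> real) \<Rightarrow> real
      \<Rightarrow> 'a \<times> 'b \<Rightarrow> nat \<Rightarrow> 'a \<times> 'b"
  where
    "gda X Y f \<eta> z0 0 = z0"
  | "gda X Y f \<eta> z0 (Suc t) =
      (let z = gda X Y f \<eta> z0 t in
        (closest_point X (fst z - \<eta> *\<^sub>R grad_x f z),
         closest_point Y (snd z + \<eta> *\<^sub>R grad_y f z)))"

(* The max over Y and the min over X are taken in the extended reals, where they always make
   sense as sup and inf.  On X \<times> Y the sup is never -\<infinity> and the inf is never \<infinity>, so no
   undefined difference arises; an unbounded gap is \<infinity>. *)
definition eps_saddle ::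
    "'a set \<Rightarrow> 'b set \<Rightarrow> ('a \<times> 'b \<Rightarrow> real) \<Rightarrow> real \<Rightarrow> 'a \<times> 'b \<Rightarrow> bool"
  where "eps_saddle X Y f \<epsilon> z \<longleftrightarrow> z \<in> X \<times> Y \<and>
    (SUP y'\<in>Y. ereal (f (fst z, y'))) - (INF x'\<in>X. ereal (f (x', snd z))) \<le> ereal \<epsilon>"

end

theory Submission
  imports Defs
begin

text \<open>
  A linear objective already forces the rate: on unit balls take \<open>f (x, y) = x \<bullet> v\<close> with
  \<open>\<parallel>v\<parallel> = 1 / (2 * C * sqrt T)\<close>, started at the centre. In \<open>T\<close> steps the iterates move by at most
  \<open>\<eta> * T * \<parallel>v\<parallel> \<le> 1 / 2\<close>, so they stay away from the boundary minimiser \<open>- v / \<parallel>v\<parallel>\<close> (and the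
  projections are never active), which leaves a gap of at least \<open>\<parallel>v\<parallel> / 2\<close>. The instance depends
  on \<open>T\<close> but not on \<open>\<eta>\<close>, has diameters bounded independently of \<open>T\<close>, and its gradients are constant.
\<close>

text \<open>Derivatives are unique and an inner-product functional determines its representing
  vector, so the definite description in \<open>grad\<close> can be evaluated.\<close>

lemma grad_eqI:
  assumes "GDERIV f x :> D"
  shows "grad f x = D"
  unfolding grad_def
proof (rule the_equality[where P = "\<lambda>D. GDERIV f x :> D", OF assms])
  fix D' assume "GDERIV f x :> D'"
  then have "(\<lambda>h. h \<bullet> D') = (\<lambda>h. h \<bullet> D)"
    using assms unfolding gderiv_def by (rule has_derivative_unique)
  then show "D' = D"
    by (metis vector_eq_ldot)
qed

lemma gderiv_inner_left: "GDERIV (\<lambda>x. x \<bullet> v) x :> v"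
  unfolding gderiv_def by (auto intro!: derivative_eq_intros)

lemma grad_x_linear: "grad_x (\<lambda>z. fst z \<bullet> v) = (\<lambda>_. v)"
  by (simp add: grad_x_def fun_eq_iff grad_eqI[OF gderiv_inner_left])

lemma grad_y_linear: "grad_y (\<lambda>z. fst z \<bullet> v) = (\<lambda>_. 0)"
  by (simp add: grad_y_def fun_eq_iff grad_eqI[OF GDERIV_const])

lemma continuously_differentiable_linear:
  "continuously_differentiable (\<lambda>z :: 'a::real_inner \<times> 'b::real_inner. fst z \<bullet> v)"
  unfolding continuously_differentiable_def gderiv_def
  by (rule exI[of _ "\<lambda>_. (v, 0)"]) (auto intro!: derivative_eq_intros simp: inner_prod_def)

lemma minimax_instance_linear:
  fixes X :: "'a::euclidean_space set" and Y :: "'b::euclidean_space set"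
  assumes "convex X" "closed X" "convex Y" "closed Y" "z0 \<in> X \<times> Y"
  shows "minimax_instance X Y (\<lambda>z. fst z \<bullet> v) z0"
proof -
  have "convex_on UNIV (\<lambda>x::'a. x \<bullet> v)"
    by (rule convex_onI) (simp_all add: inner_add_left)
  moreover have "concave_on UNIV (\<lambda>y::'b. c)" for c :: real
    by (simp add: concave_on_def convex_on_const)
  ultimately show ?thesis
    unfolding minimax_instance_def grad_x_linear grad_y_linear
    using assms continuously_differentiable_linear
    by (intro conjI exI[of _ 0] ballI) (auto simp: mem_Times_iff lipschitz_on_constant)
qed

text \<open>The gradient is constant, so steps simply add up; while the total displacement stays
  within the radius \<open>r\<close>, every unprojected point lies in the ball and projection fixes
  it.\<close>

lemma gda_linear:
  fixes v :: "'a::euclidean_space"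
  assumes "0 \<in> Y" "0 \<le> \<eta>" "\<eta> * real t * norm v \<le> r"
  shows "gda (cball 0 r) Y (\<lambda>z. fst z \<bullet> v) \<eta> (0, 0) t = (- ((\<eta> * real t) *\<^sub>R v), 0)"
  using assms(3)
proof (induction t)
  case (Suc t)
  \<comment> \<open>The radius bound at \<open>Suc t\<close> implies the one at \<open>t\<close>,
    which the induction hypothesis requires.\<close>
  have "\<eta> * real t * norm v \<le> \<eta> * real (Suc t) * norm v"
    using assms(2) by (intro mult_right_mono mult_left_mono) auto
  with Suc have IH: "gda (cball 0 r) Y (\<lambda>z. fst z \<bullet> v) \<eta> (0, 0) t = (- ((\<eta> * real t) *\<^sub>R v), 0)"
    by linarith
  have step: "- ((\<eta> * real t) *\<^sub>R v) - \<eta> *\<^sub>R v = - ((\<eta> * real (Suc t)) *\<^sub>R v)"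
    by (simp add: algebra_simps)
  have "norm (- ((\<eta> * real (Suc t)) *\<^sub>R v)) \<le> r"
    unfolding norm_minus_cancel norm_scaleR using Suc.prems assms(2) by simp
  then have "- ((\<eta> * real (Suc t)) *\<^sub>R v) \<in> cball 0 r"
    by (simp only: mem_cball_0)
  with assms(1) show ?case
    unfolding gda.simps IH Let_def grad_x_linear grad_y_linear fst_conv snd_conv step
    by (simp only: closest_point_self scaleR_zero_right add_0)
qed simp

text \<open>Any pair of competitors bounds the sup from below and the inf from above, which takes
  the argument out of the extended reals.\<close>

lemma eps_saddle_gap:
  assumes "eps_saddle X Y f \<epsilon> (x, y)" "x' \<in> X" "y' \<in> Y"
  shows "f (x, y') - f (x', y) \<le> \<epsilon>"
proof -
  have "ereal (f (x, y')) - ereal (f (x', y))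
      \<le> (SUP y'\<in>Y. ereal (f (x, y'))) - (INF x'\<in>X. ereal (f (x', y)))"
    using assms(2,3) by (intro ereal_minus_mono SUP_upper INF_lower)
  also have "\<dots> \<le> ereal \<epsilon>"
    using assms(1) by (simp add: eps_saddle_def)
  finally show ?thesis by simp
qed

theorem theorem4p2:
  fixes C :: real
  assumes "C > 0"
  shows "\<exists>c>0. \<forall>T::nat. T \<ge> 1 \<longrightarrow>
    (\<forall>\<eta>::real. 0 < \<eta> \<and> \<eta> \<le> C / sqrt (real T) \<longrightarrow>
      (\<exists>(X :: (real ^ 'n::finite) set) (Y :: (real ^ 'd::finite) set) f z0.
        minimax_instance X Y f z0 \<and>
        (\<forall>\<epsilon>>0. (\<exists>t\<le>T. eps_saddle X Y f \<epsilon> (gda X Y f \<eta> z0 t))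
          \<longrightarrow> real T \<ge> c / \<epsilon>\<^sup>2)))"
proof (intro exI[of _ "1 / (16 * C\<^sup>2)"] conjI allI impI)
  show "1 / (16 * C\<^sup>2) > 0" using assms by simp
next
  fix T :: nat and \<eta> :: real
  assume T: "T \<ge> 1" and \<eta>: "0 < \<eta> \<and> \<eta> \<le> C / sqrt (real T)"
  \<comment> \<open>This value maximises \<open>a * (1 - C * sqrt T * a)\<close>, the gap left after
    \<open>T\<close> steps of the largest admissible size.\<close>
  define a where "a = 1 / (2 * C * sqrt (real T))"
  have a: "a > 0" using assms T by (simp add: a_def)
  obtain u :: "real ^ 'n" where u: "norm u = 1"
    using vector_choose_size[of 1] by auto
  let ?X = "cball 0 1 :: (real ^ 'n) set" and ?Y = "cball 0 1 :: (real ^ 'd) set"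
  let ?f = "\<lambda>z :: (real ^ 'n) \<times> (real ^ 'd). fst z \<bullet> (a *\<^sub>R u)"
  have drift: "\<eta> * real t * a \<le> 1 / 2" if "t \<le> T" for t
  proof -
    have "\<eta> * real t * a \<le> C / sqrt (real T) * real T * a"
      using \<eta> that a assms by (intro mult_right_mono mult_mono) auto
    also have "\<dots> = 1 / 2"
      using assms T by (simp add: a_def field_simps flip: power2_eq_square)
    finally show ?thesis .
  qed
  have "1 / (16 * C\<^sup>2) / \<epsilon>\<^sup>2 \<le> real T"
    if \<epsilon>: "\<epsilon> > 0" and t: "t \<le> T" and saddle: "eps_saddle ?X ?Y ?f \<epsilon> (gda ?X ?Y ?f \<eta> (0, 0) t)"
    for \<epsilon> t
  proof -
    have "gda ?X ?Y ?f \<eta> (0, 0) t = (- ((\<eta> * real t) *\<^sub>R (a *\<^sub>R u)), 0)"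
      using \<eta> drift[OF t] a u by (intro gda_linear) auto
    with saddle have "eps_saddle ?X ?Y ?f \<epsilon> (- ((\<eta> * real t) *\<^sub>R (a *\<^sub>R u)), 0)"
      by simp
    \<comment> \<open>On the unit ball \<open>- u\<close> minimises the objective, with value
      \<open>- a\<close>; the choice of \<open>y'\<close> is free because the objective ignores
      \<open>y\<close>.\<close>
    from eps_saddle_gap[OF this, of "- u" 0] u
    have "a * (1 - \<eta> * real t * a) \<le> \<epsilon>"
      by (simp add: dot_square_norm algebra_simps)
    moreover have "a * (1 / 2) \<le> a * (1 - \<eta> * real t * a)"
      using drift[OF t] a by (intro mult_left_mono) auto
    ultimately have "a / 2 \<le> \<epsilon>"
      by linarith
    then have "(a / 2)\<^sup>2 \<le> \<epsilon>\<^sup>2"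
      using a by (intro power_mono) auto
    \<comment> \<open>This identity is the source of the constant
      \<open>1 / (16 * C\<^sup>2)\<close>.\<close>
    moreover have "(a / 2)\<^sup>2 = 1 / (16 * C\<^sup>2) / real T"
      by (simp add: a_def power_divide power_mult_distrib)
    ultimately have "1 / (16 * C\<^sup>2) / real T \<le> \<epsilon>\<^sup>2"
      by simp
    then have "1 / (16 * C\<^sup>2) \<le> \<epsilon>\<^sup>2 * real T"
      using T by (subst (asm) pos_divide_le_eq) auto
    then show ?thesis
      using \<epsilon> by (subst pos_divide_le_eq) (auto simp: mult.commute)
  qed
  moreover have "minimax_instance ?X ?Y ?f (0, 0)"
    by (rule minimax_instance_linear) auto
  ultimately show "\<exists>(X :: (real ^ 'n) set) (Y :: (real ^ 'd) set) f z0.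
      minimax_instance X Y f z0 \<and>
      (\<forall>\<epsilon>>0. (\<exists>t\<le>T. eps_saddle X Y f \<epsilon> (gda X Y f \<eta> z0 t))
        \<longrightarrow> real T \<ge> 1 / (16 * C\<^sup>2) / \<epsilon>\<^sup>2)"
    by blast
qed

end
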